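(* Let $\Gamma$ be a Jordan curve in $\mathbb{C}$ with conformal welding $h_\Gamma:\mathbb{T}\to\mathbb{T}$. Then $\Gamma$ is MP-solvable if and only if there exist two non-constant functions $\varphi,\psi\in A(\mathbb{D})$ such that $\varphi=\psi\circ h_\Gamma$ on $\mathbb{T}$.
   Context: $\widehat{\mathbb{C}}$ is the Riemann sphere, $\mathbb{D}$ the open unit disk, $\mathbb{T}$ the unit circle, $\mathbb{D}^*=\widehat{\mathbb{C}}\setminus\overline{\mathbb{D}}$. $A(\mathbb{D})$ is the disk algebra: continuous functions on $\overline{\mathbb{D}}$ that are holomorphic on $\mathbb{D}$. For a Jordan curve $\Gamma\subset\mathbb{C}$, let $\Omega$ and $\Omega^*$ be the bounded and unbounded components of $\widehat{\mathbb{C}}\setminus\Gamma$ (so $\infty\in\Omega^*$). It is assumed that $0\in\Omega$. $A(\Omega)$ is the space of continuous functions on $\overline{\Omega}$ that are analytic in $\Omega$; $A(\Omega^* )$ is the space of continuous functions on $\overline{\Omega^*}$ (closure in $\widehat{\mathbb{C}}$) that are analytic in $\Omega^*$ and vanish at $\infty$. The curve $\Gamma$ is called MP-solvable if there exist non-constant functions $f\in A(\Omega)$ and $g\in A(\Omega^* )$ such that $f=\overline{g}$ on $\Gamma$ (complex conjugate). Conformal welding: let $F:\mathbb{D}\to\Omega$ and $G:\mathbb{D}^*\to\Omega^*$ be conformal (bijective) maps with $F(0)=0$ and $G(\infty)=\infty$, with some fixed normalization making them unique (the precise choice does not matter). By Carathéodory's theorem, $F$ and $G$ extend to homeomorphisms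 of the closures, and the conformal welding of $\Gamma$ is the orientation-preserving homeomorphism $h_\Gamma:=G^{-1}\circ F:\mathbb{T}\to\mathbb{T}$. *)

theory Defs
  imports "HOL-Complex_Analysis.Complex_Analysis"
begin

section \<open>The Riemann sphere\<close>

text \<open>The Riemann sphere is the one-point compactification of the complex plane; its points are
  \<open>Some z\<close> for complex \<open>z\<close>, and the point at infinity \<open>None\<close>.\<close>

definition riemann_sphere :: "complex option topology" where
  "riemann_sphere = Alexandroff_compactification euclidean"

text \<open>The involution \<open>z \<mapsto> 1 / z\<close> of the sphere, exchanging \<open>0\<close> and infinity.\<close>

definition sphere_inv :: "complex option \<Rightarrow> complex option" where
  "sphere_inv p = (case p of None \<Rightarrow> Some 0 | Some z \<Rightarrow> if z = 0 then None else Some (1 / z))"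

text \<open>Holomorphy on an open subset \<open>U\<close> of the sphere is tested in the two standard
  parametrizations \<open>z \<mapsto> z\<close> and \<open>z \<mapsto> 1 / z\<close>, which are \<open>Some\<close> and \<open>sphere_inv \<circ> Some\<close>.\<close>

definition sphere_holomorphic_on ::
    "(complex option \<Rightarrow> complex) \<Rightarrow> complex option set \<Rightarrow> bool" where
  "sphere_holomorphic_on g U \<longleftrightarrow>
     (\<forall>a\<in>{id, sphere_inv}. (\<lambda>z. g (a (Some z))) holomorphic_on {z. a (Some z) \<in> U})"

text \<open>For maps into the sphere, the target is also read in the two charts: on the finite part
  (\<open>b = id\<close>), and in the coordinate \<open>1 / w\<close> away from \<open>w = 0\<close> (\<open>b = sphere_inv\<close>).\<close>

definition sphere_holomorphic_map_on ::
    "(complex option \<Rightarrow> complex option) \<Rightarrow> complex option set \<Rightarrow> bool" where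
  "sphere_holomorphic_map_on G U \<longleftrightarrow>
     continuous_map (subtopology riemann_sphere U) riemann_sphere G \<and>
     (\<forall>a\<in>{id, sphere_inv}. \<forall>b\<in>{id, sphere_inv}.
        (\<lambda>z. the (b (G (a (Some z))))) holomorphic_on
          {z. a (Some z) \<in> U \<and> b (G (a (Some z))) \<noteq> None})"

section \<open>Jordan curves and MP-solvability\<close>

definition jordan_curve :: "complex set \<Rightarrow> bool" where
  "jordan_curve \<Gamma> \<longleftrightarrow>
     (\<exists>c. simple_path c \<and> pathfinish c = pathstart c \<and> path_image c = \<Gamma>)"

text \<open>The bounded complementary component of \<open>\<Gamma>\<close> is \<open>inside \<Gamma>\<close>. The one containing infinity is
  \<open>ext_domain \<Gamma>\<close>, a subset of the sphere.\<close>

definition ext_domain :: "complex set \<Rightarrow> complex option set" where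
  "ext_domain \<Gamma> = insert None (Some ` outside \<Gamma>)"

definition ext_disk :: "complex option set" where
  "ext_disk = UNIV - Some ` cball 0 1"

abbreviation sphere_closure :: "complex option set \<Rightarrow> complex option set" where
  "sphere_closure U \<equiv> riemann_sphere closure_of U"

text \<open>In \<open>alg\<close> and \<open>alg_ext\<close> only the values on the closure of \<open>U\<close> are meaningful.\<close>

definition alg :: "complex set \<Rightarrow> (complex \<Rightarrow> complex) set" where
  "alg U = {f. continuous_on (closure U) f \<and> f holomorphic_on U}"

definition alg_ext :: "complex option set \<Rightarrow> (complex option \<Rightarrow> complex) set" where
  "alg_ext U =
     {g. continuous_map (subtopology riemann_sphere (sphere_closure U)) euclidean g \<and>
         sphere_holomorphic_on g U \<and> g None = 0}"

definition MP_solvable :: "complex set \<Rightarrow> bool" where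
  "MP_solvable \<Gamma> \<longleftrightarrow>
     (\<exists>f\<in>alg (inside \<Gamma>). \<exists>g\<in>alg_ext (ext_domain \<Gamma>).
        \<not> f constant_on closure (inside \<Gamma>) \<and>
        \<not> g constant_on sphere_closure (ext_domain \<Gamma>) \<and>
        (\<forall>z\<in>\<Gamma>. f z = cnj (g (Some z))))"

section \<open>Conformal welding\<close>

text \<open>The maps below are the conformal maps already extended to homeomorphisms of the closures.\<close>

definition interior_conformal_map :: "complex set \<Rightarrow> (complex \<Rightarrow> complex) \<Rightarrow> bool" where
  "interior_conformal_map \<Gamma> F \<longleftrightarrow>
     F holomorphic_on ball 0 1 \<and> bij_betw F (ball 0 1) (inside \<Gamma>) \<and> F 0 = 0 \<and>
     (\<exists>F'. homeomorphism (cball 0 1) (closure (inside \<Gamma>)) F F')"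

definition exterior_conformal_map ::
    "complex set \<Rightarrow> (complex option \<Rightarrow> complex option) \<Rightarrow> bool" where
  "exterior_conformal_map \<Gamma> G \<longleftrightarrow>
     sphere_holomorphic_map_on G ext_disk \<and> bij_betw G ext_disk (ext_domain \<Gamma>) \<and>
     G None = None \<and>
     homeomorphic_map (subtopology riemann_sphere (sphere_closure ext_disk))
       (subtopology riemann_sphere (sphere_closure (ext_domain \<Gamma>))) G"

text \<open>\<open>h = G\<inverse> \<circ> F\<close> on the unit circle. No normalization beyond \<open>F 0 = 0\<close> and \<open>G \<infinity> = \<infinity>\<close> is
  imposed, so \<open>h\<close> is a welding of \<open>\<Gamma>\<close> for an arbitrary choice of normalization.\<close>

definition conformal_welding :: "complex set \<Rightarrow> (complex \<Rightarrow> complex) \<Rightarrow> bool" where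
  "conformal_welding \<Gamma> h \<longleftrightarrow>
     (\<exists>F G. interior_conformal_map \<Gamma> F \<and> exterior_conformal_map \<Gamma> G \<and>
        (\<forall>z\<in>sphere 0 1. Some (h z) = inv_into (sphere_closure ext_disk) G (Some (F z))))"

end

theory Submission
  imports Defs
begin

text \<open>Since \<open>0\<close> lies in the bounded component, \<open>w \<mapsto> 1 / w\<close> turns the exterior domain together with
  infinity into a plane domain \<open>V\<close> and
  \<open>E w = 1 / G (1 / w)\<close> is a conformal map of the disk onto \<open>V\<close> extending to the closures. Given
  \<open>f\<close> and \<open>g\<close>, put \<open>\<phi> = f \<circ> F\<close> and \<open>\<psi> w = cnj (g (G (1 / cnj w)))\<close>, which is \<open>cnj \<circ> (g \<circ> G) \<circ> cnj\<close> read in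
  that chart and hence holomorphic; on the circle \<open>1 / cnj w = w\<close>, so \<open>G \<circ> h = F\<close> gives
  \<open>\<psi> \<circ> h = cnj \<circ> g \<circ> F = f \<circ> F = \<phi>\<close>. Both assignments are invertible, up to subtracting a constant to
  make \<open>g\<close> vanish at infinity.\<close>

section \<open>The chart at infinity\<close>

lemma topspace_riemann_sphere [simp]: "topspace riemann_sphere = UNIV"
  by (auto simp: riemann_sphere_def UNIV_option_conv)

lemma sphere_inv_involution [simp]: "sphere_inv (sphere_inv p) = p"
  by (auto simp: sphere_inv_def split: option.splits)

definition inf_chart :: "complex \<Rightarrow> complex option" where
  "inf_chart z = sphere_inv (Some z)"

text \<open>Left inverse of \<open>inf_chart\<close>. At \<open>Some 0\<close> the underlying
  \<open>the\<close> is applied to \<open>None\<close> and the value is unspecified, which is why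
  the facts using this coordinate on subsets of the sphere keep away from
  \<open>Some 0\<close>.\<close>

definition inf_coord :: "complex option \<Rightarrow> complex" where
  "inf_coord p = the (sphere_inv p)"

lemma inf_chart_0 [simp]: "inf_chart 0 = None"
  by (simp add: inf_chart_def sphere_inv_def)

lemma inf_chart_nonzero: "z \<noteq> 0 \<Longrightarrow> inf_chart z = Some (1 / z)"
  by (simp add: inf_chart_def sphere_inv_def)

lemma inf_coord_None [simp]: "inf_coord None = 0"
  by (simp add: inf_coord_def sphere_inv_def)

lemma inf_coord_Some: "z \<noteq> 0 \<Longrightarrow> inf_coord (Some z) = 1 / z"
  by (simp add: inf_coord_def sphere_inv_def)

lemma inf_coord_inf_chart [simp]: "inf_coord (inf_chart z) = z"
  by (simp add: inf_chart_def inf_coord_def)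

lemma inf_chart_inf_coord: "p \<noteq> Some 0 \<Longrightarrow> inf_chart (inf_coord p) = p"
  by (cases p) (auto simp: inf_coord_Some inf_chart_nonzero)

lemma inf_chart_neq [simp]: "inf_chart z \<noteq> Some 0"
  by (cases "z = 0") (auto simp: inf_chart_nonzero)

lemma range_inf_chart: "range inf_chart = - {Some 0}"
  by (auto simp: image_iff) (metis inf_chart_inf_coord)

lemma inj_inf_chart: "inj inf_chart"
  by (metis injI inf_coord_inf_chart)

text \<open>Passes from the compactification to the atlas description of the topology. The two agree
  at infinity because compact sets are bounded: inversion carries the outside of a large disk to a
  small punctured disk around 0.\<close>

lemma openin_riemann_sphere_charts:
  "openin riemann_sphere U \<longleftrightarrow> open (Some -` U) \<and> open (inf_chart -` U)"
proof
  assume "openin riemann_sphere U"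
  then consider V where "open V" "U = Some ` V"
    | C where "compact C" "U = insert None (Some ` (- C))"
    by (auto simp: riemann_sphere_def openin_Alexandroff_compactification Compl_eq_Diff_UNIV)
  then show "open (Some -` U) \<and> open (inf_chart -` U)"
  proof cases
    case 1
    have "inf_chart -` U = (- {0}) \<inter> (\<lambda>z. 1 / z) -` V"
    proof (intro set_eqI)
      fix z show "z \<in> inf_chart -` U \<longleftrightarrow> z \<in> (- {0}) \<inter> (\<lambda>z. 1 / z) -` V"
        by (cases "z = 0") (auto simp: 1 inf_chart_nonzero)
    qed
    moreover have "open ((- {0::complex}) \<inter> (\<lambda>z. 1 / z) -` V)"
      by (intro continuous_open_preimage continuous_intros 1) auto
    moreover have "Some -` U = V" using 1 by auto
    ultimately show ?thesis using 1 by simp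
  next
    case 2
    obtain r where r: "r > 0" "C \<subseteq> ball 0 r"
      using bounded_subset_ballD[OF compact_imp_bounded[OF 2(1)], of 0] by blast
    \<comment> \<open>Inversion is continuous only off 0, so the small disk is added to cover the
      point over infinity; it stays in the preimage because \<open>C\<close> lies in
      \<open>ball 0 r\<close>.\<close>
    have "inf_chart -` U = ball 0 (1 / r) \<union> ((- {0}) \<inter> (\<lambda>z. 1 / z) -` (- C))"
    proof (intro set_eqI)
      fix z :: complex
      show "z \<in> inf_chart -` U \<longleftrightarrow> z \<in> ball 0 (1 / r) \<union> ((- {0}) \<inter> (\<lambda>z. 1 / z) -` (- C))"
      proof (cases "z = 0")
        case True then show ?thesis using r by (simp add: 2)
      next
        case False
        have "1 / z \<notin> C" if "norm z < 1 / r"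
        proof -
          have "norm (1 / z) > r"
            using that r False by (simp add: norm_divide field_simps)
          then show ?thesis using r by auto
        qed
        then show ?thesis using False by (auto simp: inf_chart_nonzero 2)
      qed
    qed
    moreover have "open ((- {0::complex}) \<inter> (\<lambda>z. 1 / z) -` (- C))"
      by (intro continuous_open_preimage continuous_intros)
         (use 2 in \<open>auto intro: compact_imp_closed\<close>)
    moreover have "Some -` U = - C" using 2 by auto
    ultimately show ?thesis using compact_imp_closed[OF 2(1)] by (metis open_Compl open_Un open_ball)
  qed
next
  assume op: "open (Some -` U) \<and> open (inf_chart -` U)"
  show "openin riemann_sphere U"
  proof (cases "None \<in> U")
    case False
    then have "U = Some ` (Some -` U)"
      by (auto simp: image_iff) (metis option.exhaust)
    then show ?thesis
      using op by (metis open_openin openin_Alexandroff_compactification_image_Some riemann_sphere_def)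
  next
    case True
    define C where "C = - (Some -` U)"
    have "0 \<in> inf_chart -` U" using True by simp
    then obtain r where r: "r > 0" "ball 0 r \<subseteq> inf_chart -` U"
      using op open_contains_ball by blast
    \<comment> \<open>The chart disk of radius \<open>r\<close> over infinity lies in the preimage
      of \<open>U\<close>, so every finite point of modulus above \<open>1 / r\<close> belongs to
      \<open>U\<close>. This bounds the complement and makes it compact.\<close>
    have "C \<subseteq> cball 0 (1 / r)"
    proof
      fix z assume z: "z \<in> C"
      show "z \<in> cball 0 (1 / r)"
      proof (rule ccontr)
        assume "z \<notin> cball 0 (1 / r)"
        then have n: "norm z > 1 / r" by simp
        then have "z \<noteq> 0" using r by auto
        have "norm (1 / z) < r" using n r \<open>z \<noteq> 0\<close> by (simp add: norm_divide field_simps)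
        then have "inf_chart (1 / z) \<in> U" using r by (simp add: subset_iff)
        then show False using z \<open>z \<noteq> 0\<close> by (simp add: C_def inf_chart_nonzero)
      qed
    qed
    then have "compact C"
      using op bounded_subset[OF bounded_cball]
      by (auto simp: C_def compact_eq_bounded_closed closed_def)
    moreover have "U = insert None (Some ` (UNIV - C))"
      using True notin_range_Some by (fastforce simp: C_def image_iff)
    ultimately show ?thesis
      unfolding riemann_sphere_def openin_Alexandroff_compactification
      by (intro disjI2 exI[of _ C]) (auto simp: compact_imp_closed)
  qed
qed

text \<open>By the chart criterion for openness, continuity is immediate, and openness of the map
  reduces to openness of the inverted set off 0. An injective, continuous and open map is an
  embedding.\<close>

lemma homeomorphic_maps_inf_chart:
  "homeomorphic_maps euclidean (subtopology riemann_sphere (- {Some 0})) inf_chart inf_coord"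
proof -
  have cont: "continuous_map euclidean riemann_sphere inf_chart"
    by (auto simp: continuous_map_def openin_riemann_sphere_charts vimage_def)
  have op: "open_map euclidean riemann_sphere inf_chart"
    unfolding open_map_def
  proof (intro allI impI)
    fix V :: "complex set" assume "openin euclidean V"
    then have V: "open V" by simp
    have "Some -` (inf_chart ` V) = (- {0}) \<inter> (\<lambda>z. 1 / z) -` V"
    proof (intro set_eqI)
      fix z :: complex
      have "Some 0 \<notin> inf_chart ` V" by (metis imageE inf_chart_neq)
      moreover have "Some z = inf_chart (1 / z)" if "z \<noteq> 0"
        using that by (simp add: inf_chart_nonzero)
      ultimately show "z \<in> Some -` (inf_chart ` V) \<longleftrightarrow> z \<in> (- {0}) \<inter> (\<lambda>z. 1 / z) -` V"
        by (cases "z = 0") (auto simp: inj_image_mem_iff[OF inj_inf_chart])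
    qed
    moreover have "open ((- {0::complex}) \<inter> (\<lambda>z. 1 / z) -` V)"
      by (intro continuous_open_preimage continuous_intros V) auto
    moreover have "inf_chart -` (inf_chart ` V) = V"
      by (simp add: inj_inf_chart inj_vimage_image_eq)
    ultimately show "openin riemann_sphere (inf_chart ` V)"
      using V by (simp add: openin_riemann_sphere_charts)
  qed
  have "homeomorphic_map euclidean (subtopology riemann_sphere (- {Some 0})) inf_chart"
    using injective_open_imp_embedding_map[OF cont op]
    by (simp add: inj_inf_chart embedding_map_def range_inf_chart)
  then obtain g where g: "homeomorphic_maps euclidean (subtopology riemann_sphere (- {Some 0})) inf_chart g"
    using homeomorphic_map_maps by blast
  show ?thesis
  \<comment> \<open>The abstract inverse \<open>g\<close> satisfies
    \<open>inf_chart (g p) = p\<close>; applying \<open>inf_coord\<close> to both sides identifies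
    it with \<open>inf_coord\<close> on the range.\<close>
  proof (rule homeomorphic_maps_eq[OF g])
    fix p assume p: "p \<in> topspace (subtopology riemann_sphere (- {Some 0}))"
    then show "g p = inf_coord p"
      using g unfolding homeomorphic_maps_def by (metis inf_coord_inf_chart)
  qed auto
qed

lemma homeomorphic_maps_inf_chart_subset:
  assumes "Some 0 \<notin> C"
  shows "homeomorphic_maps (top_of_set (inf_chart -` C)) (subtopology riemann_sphere C) inf_chart inf_coord"
proof -
  have "inf_chart ` (inf_chart -` C) = C"
    using assms range_inf_chart by auto
  then have "homeomorphic_maps (top_of_set (inf_chart -` C))
      (subtopology (subtopology riemann_sphere (- {Some 0})) C) inf_chart inf_coord"
    by (intro homeomorphic_maps_subtopologies homeomorphic_maps_inf_chart) (use assms in auto)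
  moreover have "- {Some 0} \<inter> C = C" using assms by auto
  ultimately show ?thesis by (simp add: subtopology_subtopology)
qed

text \<open>A homeomorphism preserves closures, and the closure within the range of the chart is the
  trace of the closure in the sphere. If \<open>Some 0\<close> lies in the latter, it has no chart
  preimage and does no harm.\<close>

lemma closure_inf_chart_vimage:
  assumes "Some 0 \<notin> U"
  shows "closure (inf_chart -` U) = inf_chart -` sphere_closure U"
proof -
  let ?S = "subtopology riemann_sphere (- {Some 0})"
  have U: "U = inf_chart ` (inf_chart -` U)"
    using assms range_inf_chart by auto
  have "homeomorphic_map euclidean ?S inf_chart"
    using homeomorphic_maps_inf_chart homeomorphic_map_maps by blast
  from homeomorphic_map_closure_of[OF this, of "inf_chart -` U"]
  have "?S closure_of U = inf_chart ` closure (inf_chart -` U)"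
    using U by simp
  moreover have "?S closure_of U = - {Some 0} \<inter> sphere_closure U"
    using assms by (intro closure_of_subtopology_open) auto
  ultimately have "inf_chart ` closure (inf_chart -` U) = - {Some 0} \<inter> sphere_closure U"
    by simp
  then have "inf_chart -` (inf_chart ` closure (inf_chart -` U)) = inf_chart -` sphere_closure U"
    by auto
  then show ?thesis by (simp add: inj_inf_chart inj_vimage_image_eq)
qed

text \<open>Keeping 0 off the closure, and not merely off \<open>U\<close>, places the whole closure
  in the chart at infinity, so continuity and holomorphy both become conditions in the
  plane.\<close>

lemma alg_ext_iff:
  assumes "Some 0 \<notin> sphere_closure U"
  shows "g \<in> alg_ext U \<longleftrightarrow> g \<circ> inf_chart \<in> alg (inf_chart -` U) \<and> g None = 0"
proof -
  have U: "Some 0 \<notin> U" using assms closure_of_subset[of U riemann_sphere] by auto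
  note hm = homeomorphic_maps_inf_chart_subset[OF assms]
  have "continuous_map (subtopology riemann_sphere (sphere_closure U)) euclidean g \<longleftrightarrow>
      continuous_on (closure (inf_chart -` U)) (g \<circ> inf_chart)" (is "?L \<longleftrightarrow> ?R")
  proof
    assume ?L
    with hm have "continuous_map (top_of_set (inf_chart -` sphere_closure U)) euclidean (g \<circ> inf_chart)"
      unfolding homeomorphic_maps_def by (blast intro: continuous_map_compose)
    then show ?R by (simp add: closure_inf_chart_vimage[OF U])
  next
    assume ?R
    then have "continuous_map (top_of_set (inf_chart -` sphere_closure U)) euclidean (g \<circ> inf_chart)"
      by (simp add: closure_inf_chart_vimage[OF U])
    with hm have "continuous_map (subtopology riemann_sphere (sphere_closure U)) euclidean
        ((g \<circ> inf_chart) \<circ> inf_coord)"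
      unfolding homeomorphic_maps_def by (blast intro: continuous_map_compose)
    then show ?L
    proof (rule continuous_map_eq)
      fix p assume "p \<in> topspace (subtopology riemann_sphere (sphere_closure U))"
      then have "p \<noteq> Some 0" using assms by auto
      then show "((g \<circ> inf_chart) \<circ> inf_coord) p = g p" by (simp add: inf_chart_inf_coord)
    qed
  qed
  moreover have "sphere_holomorphic_on g U \<longleftrightarrow> (g \<circ> inf_chart) holomorphic_on (inf_chart -` U)"
  proof
    assume "sphere_holomorphic_on g U"
    then show "(g \<circ> inf_chart) holomorphic_on (inf_chart -` U)"
      by (simp add: sphere_holomorphic_on_def inf_chart_def comp_def vimage_def)
  next
    assume R: "(g \<circ> inf_chart) holomorphic_on (inf_chart -` U)"
    \<comment> \<open>Holomorphy in the finite chart follows from that at infinity through the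
      transition map, which is holomorphic here because 0 is not in \<open>U\<close>.\<close>
    have "((g \<circ> inf_chart) \<circ> (\<lambda>z. 1 / z)) holomorphic_on (Some -` U)"
    proof (rule holomorphic_on_compose_gen[OF _ R])
      show "(\<lambda>z. 1 / z) holomorphic_on Some -` U"
        using U by (intro holomorphic_intros) auto
      show "(\<lambda>z. 1 / z) ` (Some -` U) \<subseteq> inf_chart -` U"
      proof (rule image_subsetI)
        fix z assume "z \<in> Some -` U"
        then show "1 / z \<in> inf_chart -` U"
          using U by (cases "z = 0") (simp_all add: inf_chart_nonzero)
      qed
    qed
    then have "(\<lambda>z. g (Some z)) holomorphic_on (Some -` U)"
    proof (rule holomorphic_transform)
      fix z assume "z \<in> Some -` U"
      then have "z \<noteq> 0" using U by auto
      then show "((g \<circ> inf_chart) \<circ> (\<lambda>z. 1 / z)) z = g (Some z)"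
        by (simp add: inf_chart_nonzero)
    qed
    with R show "sphere_holomorphic_on g U"
      by (simp add: sphere_holomorphic_on_def inf_chart_def comp_def vimage_def)
  qed
  ultimately show ?thesis by (auto simp: alg_ext_def alg_def)
qed

section \<open>Transporting disk algebras along conformal maps\<close>

lemma alg_compose_conformal:
  assumes "F holomorphic_on U" "bij_betw F U V" "homeomorphism (closure U) (closure V) F F'" "f \<in> alg V"
  shows "f \<circ> F \<in> alg U"
proof -
  have "continuous_on (closure U) (f \<circ> F)"
    using assms by (metis (mono_tags, lifting) alg_def continuous_on_compose homeomorphism_def mem_Collect_eq)
  moreover have "f \<circ> F holomorphic_on U"
    using assms by (intro holomorphic_on_compose_gen[of F _ f V]) (auto simp: alg_def bij_betw_def)
  ultimately show ?thesis by (simp add: alg_def)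
qed

text \<open>An injective holomorphic map on an open set has a holomorphic inverse, and this inverse
  coincides with \<open>F'\<close> on \<open>V\<close>. Hence the preceding lemma applies with the
  two domains exchanged.\<close>

lemma alg_compose_conformal_inverse:
  assumes "F holomorphic_on U" "bij_betw F U V" "homeomorphism (closure U) (closure V) F F'" "open U"
    "f \<in> alg U"
  shows "f \<circ> F' \<in> alg V"
proof (rule alg_compose_conformal[OF _ _ homeomorphism_symD[OF assms(3)] assms(5)])
  have F': "F' (F z) = z" if "z \<in> U" for z
    using assms(3) that closure_subset by (auto simp: homeomorphism_def)
  have V: "V = F ` U" using assms(2) by (simp add: bij_betw_def)
  obtain g where g: "g holomorphic_on F ` U" "\<And>z. z \<in> U \<Longrightarrow> g (F z) = z"
    using holomorphic_has_inverse[OF assms(1,4)] assms(2) bij_betw_def by metis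
  show "F' holomorphic_on V"
    unfolding V by (rule holomorphic_transform[OF g(1)]) (use g F' in auto)
  show "bij_betw F' V U"
    unfolding V using F' by (intro bij_betwI[of _ _ _ F]) auto
qed

lemma cnj_image_ball: "cnj ` ball 0 r = ball 0 r" "cnj ` cball 0 r = cball 0 r"
proof -
  have "x \<in> cnj ` A \<longleftrightarrow> cnj x \<in> A" for x A
    by (metis complex_cnj_cnj image_iff)
  then show "cnj ` ball 0 r = ball 0 r" "cnj ` cball 0 r = cball 0 r" by auto
qed

text \<open>The two conjugations cancel in the Cauchy-Riemann equations, and the disk is symmetric
  about the real axis. This reflection absorbs the complex conjugate in the boundary condition of
  MP-solvability.\<close>

lemma alg_cnj_reflect:
  assumes "f \<in> alg (ball 0 r)"
  shows "cnj \<circ> f \<circ> cnj \<in> alg (ball 0 r)"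
proof -
  have im: "cnj ` closure (ball 0 r) = closure (ball 0 r)"
    \<comment> \<open>The closure of the open ball is the closed ball only for positive
      \<open>r\<close>; otherwise both sides are empty.\<close>
    using cnj_image_ball(2)[of r] by (cases "r > 0") (auto simp: ball_empty)
  have "cnj \<circ> f \<circ> cnj holomorphic_on ball 0 r"
    using assms by (intro holomorphic_on_compose_cnj_cnj) (auto simp: alg_def cnj_image_ball)
  moreover have "continuous_on (closure (ball 0 r)) (cnj \<circ> f \<circ> cnj)"
    using assms im by (intro continuous_on_compose continuous_intros) (auto simp: alg_def)
  ultimately show ?thesis by (simp add: alg_def)
qed

lemma constant_on_comp_image:
  "(f \<circ> F) constant_on A \<longleftrightarrow> f constant_on F ` A"
  by (auto simp: constant_on_def)

lemma constant_on_cnj_reflect: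
  "(cnj \<circ> f \<circ> cnj) constant_on cball 0 r \<longleftrightarrow> f constant_on cball 0 r"
proof -
  have "(cnj \<circ> f) constant_on cball 0 r \<longleftrightarrow> f constant_on cball 0 r"
    by (auto simp: constant_on_def) (metis complex_cnj_cnj)
  then show ?thesis by (simp add: constant_on_comp_image cnj_image_ball)
qed

lemma constant_on_diff_const:
  fixes f :: "'a \<Rightarrow> 'b::group_add"
  shows "(\<lambda>z. f z - c) constant_on A \<longleftrightarrow> f constant_on A"
  unfolding constant_on_def by (metis diff_add_cancel)

lemma alg_diff_const: "f \<in> alg U \<Longrightarrow> (\<lambda>z. f z - c) \<in> alg U"
  by (auto simp: alg_def intro!: continuous_intros holomorphic_intros)

section \<open>The exterior domain in the chart at infinity\<close>

lemma zero_notin_sphere_closure: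
  assumes "open W" "0 \<in> W" "Some ` W \<inter> U = {}"
  shows "Some 0 \<notin> sphere_closure U"
proof
  assume "Some 0 \<in> sphere_closure U"
  moreover have "openin riemann_sphere (Some ` W)"
    using assms by (simp add: riemann_sphere_def)
  ultimately show False using assms by (auto simp: in_closure_of)
qed

text \<open>The open set \<open>inside \<Gamma>\<close> is a neighbourhood of 0 that misses the
  exterior. This is what lets a single chart serve the closed exterior domain.\<close>

lemma zero_notin_closure_ext_domain:
  assumes "closed \<Gamma>" "0 \<in> inside \<Gamma>"
  shows "Some 0 \<notin> sphere_closure (ext_domain \<Gamma>)"
proof (rule zero_notin_sphere_closure)
  show "Some ` inside \<Gamma> \<inter> ext_domain \<Gamma> = {}"
    using inside_Int_outside[of \<Gamma>] by (auto simp: ext_domain_def disjoint_iff simp del: inside_Int_outside)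
qed (use assms open_inside in auto)

lemma zero_notin_closure_ext_disk: "Some 0 \<notin> sphere_closure ext_disk"
  by (rule zero_notin_sphere_closure[of "ball 0 1"]) (auto simp: ext_disk_def)

lemma inf_chart_vimage_ext_disk: "inf_chart -` ext_disk = ball 0 1"
proof (intro set_eqI)
  fix z show "z \<in> inf_chart -` ext_disk \<longleftrightarrow> z \<in> ball 0 1"
    by (cases "z = 0") (auto simp: ext_disk_def inf_chart_nonzero norm_divide)
qed

lemma subset_sphere_closure: "U \<subseteq> sphere_closure U"
  by (simp add: closure_of_subset)

lemma inf_chart_vimage_closure_ext_disk: "inf_chart -` sphere_closure ext_disk = cball 0 1"
  using closure_inf_chart_vimage[of ext_disk] zero_notin_closure_ext_disk subset_sphere_closure
  by (auto simp: inf_chart_vimage_ext_disk)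

lemma image_inf_chart_vimage:
  "Some 0 \<notin> U \<Longrightarrow> inf_chart ` (inf_chart -` U) = U"
  using range_inf_chart by auto

text \<open>\<open>E\<close> is the coordinate expression of \<open>G\<close> at infinity in both
  source and target. Holomorphy is therefore one of the four cases of
  \<open>sphere_holomorphic_map_on\<close>, and the closures correspond by composing three
  homeomorphisms.\<close>

lemma exterior_conformal_map_inf_chart:
  fixes \<Gamma> G
  defines "E \<equiv> inf_coord \<circ> G \<circ> inf_chart" and "V \<equiv> inf_chart -` ext_domain \<Gamma>"
  assumes G: "exterior_conformal_map \<Gamma> G" and zero: "Some 0 \<notin> sphere_closure (ext_domain \<Gamma>)"
  shows "E holomorphic_on ball 0 1" "bij_betw E (ball 0 1) V"
    "\<exists>E'. homeomorphism (closure (ball 0 1)) (closure V) E E'"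
proof -
  have zero': "Some 0 \<notin> ext_domain \<Gamma>" using zero subset_sphere_closure by blast
  have bij: "bij_betw G ext_disk (ext_domain \<Gamma>)" using G by (simp add: exterior_conformal_map_def)
  have Gin: "G (inf_chart z) \<in> ext_domain \<Gamma>" if "z \<in> ball 0 1" for z
    using bij_betwE[OF bij] that inf_chart_vimage_ext_disk by blast
  have "sphere_holomorphic_map_on G ext_disk" using G by (simp add: exterior_conformal_map_def)
  then have "(\<lambda>z. the (sphere_inv (G (inf_chart z)))) holomorphic_on
      {z. inf_chart z \<in> ext_disk \<and> sphere_inv (G (inf_chart z)) \<noteq> None}"
    unfolding sphere_holomorphic_map_on_def inf_chart_def by blast
  \<comment> \<open>The coordinate expression is defined on the full disk, since \<open>G\<close>
    never takes the value \<open>Some 0\<close> on \<open>ext_disk\<close>.\<close>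
  moreover have "{z. inf_chart z \<in> ext_disk \<and> sphere_inv (G (inf_chart z)) \<noteq> None} = ball 0 1"
  proof -
    have "sphere_inv p \<noteq> None" if "p \<in> ext_domain \<Gamma>" for p
      using that zero' by (auto simp: sphere_inv_def split: option.splits)
    then show ?thesis using Gin inf_chart_vimage_ext_disk by blast
  qed
  ultimately show "E holomorphic_on ball 0 1"
    by (simp add: E_def inf_coord_def comp_def)
  have "Some 0 \<notin> ext_disk" by (simp add: ext_disk_def)
  then have "inf_chart ` ball 0 1 = ext_disk"
    using image_inf_chart_vimage[of ext_disk] by (simp add: inf_chart_vimage_ext_disk)
  then have "bij_betw inf_chart (ball 0 1) ext_disk"
    using inj_on_subset[OF inj_inf_chart] by (simp add: bij_betw_def)
  moreover have "bij_betw inf_coord (ext_domain \<Gamma>) V"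
    unfolding V_def using zero'
    by (intro bij_betwI[of _ _ _ inf_chart]) (auto, metis inf_chart_inf_coord, metis inf_chart_inf_coord)
  ultimately show "bij_betw E (ball 0 1) V"
    unfolding E_def using bij by (metis bij_betw_trans)
  have clV: "inf_chart -` sphere_closure (ext_domain \<Gamma>) = closure V"
    unfolding V_def using closure_inf_chart_vimage zero' by simp
  have "homeomorphic_map (top_of_set (cball 0 1)) (subtopology riemann_sphere (sphere_closure ext_disk)) inf_chart"
    using homeomorphic_maps_inf_chart_subset[OF zero_notin_closure_ext_disk]
    by (simp add: inf_chart_vimage_closure_ext_disk homeomorphic_maps_map)
  moreover have "homeomorphic_map (subtopology riemann_sphere (sphere_closure ext_disk))
      (subtopology riemann_sphere (sphere_closure (ext_domain \<Gamma>))) G"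
    using G by (simp add: exterior_conformal_map_def)
  moreover have "homeomorphic_map (subtopology riemann_sphere (sphere_closure (ext_domain \<Gamma>)))
      (top_of_set (closure V)) inf_coord"
    using homeomorphic_maps_inf_chart_subset[OF zero] by (simp add: clV homeomorphic_maps_map)
  ultimately have "homeomorphic_map (top_of_set (cball 0 1)) (top_of_set (closure V)) E"
    unfolding E_def by (metis homeomorphic_map_compose comp_assoc)
  then obtain E' where E': "homeomorphic_maps (top_of_set (cball 0 1)) (top_of_set (closure V)) E E'"
    using homeomorphic_map_maps by blast
  then have "homeomorphism (cball 0 1) (closure V) E E'"
    unfolding homeomorphic_maps_def
    by (intro homeomorphismI) (auto simp: image_subset_iff_funcset)
  then show "\<exists>E'. homeomorphism (closure (ball 0 1)) (closure V) E E'"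
    by auto
qed

text \<open>The plane version drops the condition that \<open>g\<close> vanish at infinity; the
  additive constants of \<open>f\<close> and \<open>g\<close> are free enough to restore it.\<close>

lemma MP_solvable_inf_chart:
  assumes "closed \<Gamma>" and "0 \<in> inside \<Gamma>"
  defines "V \<equiv> inf_chart -` ext_domain \<Gamma>"
  shows "MP_solvable \<Gamma> \<longleftrightarrow>
    (\<exists>f\<in>alg (inside \<Gamma>). \<exists>g\<in>alg V. \<not> f constant_on closure (inside \<Gamma>) \<and>
      \<not> g constant_on closure V \<and> (\<forall>z\<in>\<Gamma>. f z = cnj (g (1 / z))))"
    (is "_ \<longleftrightarrow> ?R")
proof -
  note zero = zero_notin_closure_ext_domain[OF assms(1,2)]
  have clV: "inf_chart -` sphere_closure (ext_domain \<Gamma>) = closure V"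
    unfolding V_def using closure_inf_chart_vimage zero subset_sphere_closure by blast
  then have im: "inf_chart ` closure V = sphere_closure (ext_domain \<Gamma>)"
    using image_inf_chart_vimage[OF zero] by simp
  have chart: "inf_chart (1 / z) = Some z" if "z \<in> \<Gamma>" for z
  proof -
    have "z \<noteq> 0" using assms(2) that by (metis disjoint_iff inside_no_overlap)
    then show ?thesis by (simp add: inf_chart_nonzero)
  qed
  show ?thesis
  proof
    assume "MP_solvable \<Gamma>"
    then obtain f g where f: "f \<in> alg (inside \<Gamma>)" "\<not> f constant_on closure (inside \<Gamma>)"
      and g: "g \<in> alg_ext (ext_domain \<Gamma>)" "\<not> g constant_on sphere_closure (ext_domain \<Gamma>)"
      and eq: "\<And>z. z \<in> \<Gamma> \<Longrightarrow> f z = cnj (g (Some z))"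
      unfolding MP_solvable_def by blast
    have "g \<circ> inf_chart \<in> alg V" using g(1) alg_ext_iff[OF zero] by (simp add: V_def)
    moreover have "\<not> (g \<circ> inf_chart) constant_on closure V"
      using g(2) by (simp add: constant_on_comp_image im)
    moreover have "\<forall>z\<in>\<Gamma>. f z = cnj ((g \<circ> inf_chart) (1 / z))"
      using eq chart by simp
    ultimately show ?R using f by blast
  next
    assume ?R
    then obtain f g where f: "f \<in> alg (inside \<Gamma>)" "\<not> f constant_on closure (inside \<Gamma>)"
      and g: "g \<in> alg V" "\<not> g constant_on closure V"
      and eq: "\<And>z. z \<in> \<Gamma> \<Longrightarrow> f z = cnj (g (1 / z))"
      by blast
    \<comment> \<open>The chart point 0 is infinity, so subtracting \<open>g 0\<close> gives
      \<open>g1 None = 0\<close>. Subtracting its conjugate from \<open>f\<close> preserves the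
      boundary identity.\<close>
    define f1 g1 where "f1 = (\<lambda>z. f z - cnj (g 0))" and "g1 = (\<lambda>w. g w - g 0) \<circ> inf_coord"
    have g1: "g1 \<circ> inf_chart = (\<lambda>w. g w - g 0)" by (auto simp: g1_def)
    have "f1 \<in> alg (inside \<Gamma>)" "\<not> f1 constant_on closure (inside \<Gamma>)"
      using f by (simp_all add: f1_def alg_diff_const constant_on_diff_const)
    moreover have "g1 \<in> alg_ext (ext_domain \<Gamma>)"
      using g alg_diff_const unfolding alg_ext_iff[OF zero] g1 V_def by (simp add: g1_def)
    moreover have "\<not> g1 constant_on sphere_closure (ext_domain \<Gamma>)"
      unfolding im[symmetric] constant_on_comp_image[symmetric] g1 using g by (simp add: constant_on_diff_const)
    moreover have "\<forall>z\<in>\<Gamma>. f1 z = cnj (g1 (Some z))"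
    proof
      fix z assume z: "z \<in> \<Gamma>"
      then have "g1 (Some z) = g (1 / z) - g 0"
        using fun_cong[OF g1, of "1 / z"] chart by simp
      then show "f1 z = cnj (g1 (Some z))" using eq[OF z] by (simp add: f1_def)
    qed
    ultimately show "MP_solvable \<Gamma>" unfolding MP_solvable_def by blast
  qed
qed

section \<open>Boundary correspondence of the conformal maps\<close>

lemma jordan_curve_facts:
  assumes "jordan_curve \<Gamma>"
  shows "closed \<Gamma>" "frontier (inside \<Gamma>) = \<Gamma>" "frontier (outside \<Gamma>) = \<Gamma>"
  using assms Jordan_inside_outside closed_simple_path_image unfolding jordan_curve_def by blast+

text \<open>Points of the curve are frontier points of \<open>outside \<Gamma>\<close>, and a sphere
  neighbourhood of a finite point restricts to a plane neighbourhood.\<close>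

lemma jordan_curve_subset_closure_ext_domain:
  assumes "jordan_curve \<Gamma>" "z \<in> \<Gamma>"
  shows "Some z \<in> sphere_closure (ext_domain \<Gamma>)"
proof -
  have z: "z \<in> closure (outside \<Gamma>)"
    using assms jordan_curve_facts(3) by (auto simp: frontier_def)
  have "\<exists>y\<in>ext_domain \<Gamma>. y \<in> T" if "Some z \<in> T" "openin riemann_sphere T" for T
  proof -
    have "open (Some -` T)" "z \<in> Some -` T"
      using that by (auto simp: openin_riemann_sphere_charts)
    then obtain y where "y \<in> outside \<Gamma>" "y \<in> Some -` T"
      using z open_Int_closure_eq_empty[of "Some -` T" "outside \<Gamma>"] by blast
    then show ?thesis by (auto simp: ext_domain_def)
  qed
  then show ?thesis by (auto simp: in_closure_of)
qed

text \<open>\<open>F\<close> is injective on the closed disk and takes the open disk onto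
  \<open>inside \<Gamma>\<close>, so the remaining circle goes onto the closure minus the interior
  domain, which is the frontier.\<close>

lemma interior_conformal_map_circle:
  assumes "jordan_curve \<Gamma>" "interior_conformal_map \<Gamma> F"
  shows "F ` sphere 0 1 = \<Gamma>"
proof -
  obtain F' where "homeomorphism (cball 0 1) (closure (inside \<Gamma>)) F F'"
    and bij: "bij_betw F (ball 0 1) (inside \<Gamma>)"
    using assms(2) by (auto simp: interior_conformal_map_def)
  then have inj: "inj_on F (cball 0 1)" and im: "F ` cball 0 1 = closure (inside \<Gamma>)"
    by (auto simp: homeomorphism_def intro: inj_on_inverseI)
  have "sphere 0 1 = cball 0 1 - ball (0::complex) 1" by auto
  also have "F ` \<dots> = F ` cball 0 1 - F ` ball 0 1"
    by (rule inj_on_image_set_diff[OF inj]) auto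
  also have "\<dots> = frontier (inside \<Gamma>)"
    using im bij jordan_curve_facts(1)[OF assms(1)]
    by (simp add: bij_betw_def frontier_def interior_open open_inside)
  finally show ?thesis using jordan_curve_facts[OF assms(1)] by simp
qed

text \<open>Shows that \<open>inv_into\<close> is a genuine preimage and that the welding takes
  values on the circle: the preimage lies in the closure of \<open>ext_disk\<close> but not in
  \<open>ext_disk\<close> itself.\<close>

lemma exterior_conformal_map_inv_into_circle:
  assumes "jordan_curve \<Gamma>" "exterior_conformal_map \<Gamma> G" "\<zeta> \<in> \<Gamma>"
    and "Some w = inv_into (sphere_closure ext_disk) G (Some \<zeta>)"
  shows "norm w = 1" "G (Some w) = Some \<zeta>"
proof -
  have im: "G ` sphere_closure ext_disk = sphere_closure (ext_domain \<Gamma>)"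
    using assms(2) homeomorphic_imp_surjective_map by (fastforce simp: exterior_conformal_map_def)
  have mem: "Some \<zeta> \<in> G ` sphere_closure ext_disk"
    unfolding im using assms jordan_curve_subset_closure_ext_domain by blast
  show G: "G (Some w) = Some \<zeta>"
    using f_inv_into_f[OF mem] assms(4) by simp
  have w: "Some w \<in> sphere_closure ext_disk"
    using inv_into_into[OF mem] assms(4) by simp
  \<comment> \<open>Points of \<open>ext_disk\<close> are sent to the exterior domain, which misses
    the curve; hence the modulus of \<open>w\<close> is at most 1. The chart at infinity then gives
    the reverse bound.\<close>
  have "\<zeta> \<notin> outside \<Gamma>" using assms(3) outside_no_overlap by blast
  then have "Some w \<notin> ext_disk"
    using G assms(2) bij_betwE[of G ext_disk "ext_domain \<Gamma>"]
    by (fastforce simp: exterior_conformal_map_def ext_domain_def)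
  then have "norm w \<le> 1" by (auto simp: ext_disk_def)
  moreover have "w \<noteq> 0" using w zero_notin_closure_ext_disk by auto
  moreover have "1 / w \<in> cball 0 1"
    unfolding inf_chart_vimage_closure_ext_disk[symmetric]
    using w \<open>w \<noteq> 0\<close> by (simp add: inf_chart_nonzero)
  ultimately show "norm w = 1"
    by (simp add: norm_divide field_simps)
qed

section \<open>Equivalence of MP-solvability and the welding equation\<close>

theorem theorem3p1:
  fixes \<Gamma> :: "complex set" and h :: "complex \<Rightarrow> complex"
  assumes "jordan_curve \<Gamma>" and "0 \<in> inside \<Gamma>" and "conformal_welding \<Gamma> h"
  shows "MP_solvable \<Gamma> \<longleftrightarrow>
    (\<exists>\<phi>\<in>alg (ball 0 1). \<exists>\<psi>\<in>alg (ball 0 1).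
       \<not> \<phi> constant_on cball 0 1 \<and> \<not> \<psi> constant_on cball 0 1 \<and>
       (\<forall>z\<in>sphere 0 1. \<phi> z = \<psi> (h z)))"
    (is "_ \<longleftrightarrow> ?R")
proof -
  obtain F G where F: "interior_conformal_map \<Gamma> F" and G: "exterior_conformal_map \<Gamma> G"
    and h: "\<And>z. z \<in> sphere 0 1 \<Longrightarrow>
      Some (h z) = inv_into (sphere_closure ext_disk) G (Some (F z))"
    using assms(3) unfolding conformal_welding_def by blast
  obtain F' where hF: "F holomorphic_on ball 0 1" and bF: "bij_betw F (ball 0 1) (inside \<Gamma>)"
    and F': "homeomorphism (closure (ball 0 1)) (closure (inside \<Gamma>)) F F'"
    using F by (auto simp: interior_conformal_map_def)
  have closed: "closed \<Gamma>" using assms jordan_curve_facts by blast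
  note zero = zero_notin_closure_ext_domain[OF closed assms(2)]
  define V where "V = inf_chart -` ext_domain \<Gamma>"
  define E where "E = inf_coord \<circ> G \<circ> inf_chart"
  note E = exterior_conformal_map_inf_chart[OF G zero, folded E_def V_def]
  obtain E' where E': "homeomorphism (closure (ball 0 1)) (closure V) E E'"
    using E(3) by blast
  have imF: "F ` cball 0 1 = closure (inside \<Gamma>)" and imE: "E ` cball 0 1 = closure V"
    and imF': "F' ` closure (inside \<Gamma>) = cball 0 1" and imE': "E' ` closure V = cball 0 1"
    using F' E' by (simp_all add: homeomorphism_def)
  have circle: "F ` sphere 0 1 = \<Gamma>"
    using interior_conformal_map_circle assms(1) F by blast
  have weld: "norm (h z) = 1 \<and> E (cnj (h z)) = 1 / F z" if z: "z \<in> sphere 0 1" for z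
  proof -
    \<comment> \<open>On the unit circle conjugation is inversion, so
      \<open>inf_chart (cnj (h z))\<close> is \<open>Some (h z)\<close>. There \<open>G\<close> has
      the value \<open>Some (F z)\<close>, whose coordinate at infinity is
      \<open>1 / F z\<close>.\<close>
    have "F z \<in> \<Gamma>" using circle z by blast
    note w = exterior_conformal_map_inv_into_circle[OF assms(1) G this h[OF z]]
    have "h z \<noteq> 0" using w by auto
    have "cnj (h z) = 1 / h z"
      using w(1) \<open>h z \<noteq> 0\<close> by (simp add: field_simps complex_norm_square[symmetric] mult.commute)
    moreover have "F z \<noteq> 0"
      using \<open>F z \<in> \<Gamma>\<close> assms(2) by (metis disjoint_iff inside_no_overlap)
    ultimately have "E (cnj (h z)) = 1 / F z"
      using w(2) \<open>h z \<noteq> 0\<close> by (simp add: E_def inf_chart_nonzero inf_coord_Some)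
    then show ?thesis using w by simp
  qed
  have "MP_solvable \<Gamma> \<longleftrightarrow>
    (\<exists>f\<in>alg (inside \<Gamma>). \<exists>g\<in>alg V. \<not> f constant_on closure (inside \<Gamma>) \<and>
      \<not> g constant_on closure V \<and> (\<forall>z\<in>\<Gamma>. f z = cnj (g (1 / z))))"
    unfolding V_def by (rule MP_solvable_inf_chart[OF closed assms(2)])
  also have "\<dots> \<longleftrightarrow> ?R"
  proof
    assume "\<exists>f\<in>alg (inside \<Gamma>). \<exists>g\<in>alg V. \<not> f constant_on closure (inside \<Gamma>) \<and>
      \<not> g constant_on closure V \<and> (\<forall>z\<in>\<Gamma>. f z = cnj (g (1 / z)))"
    then obtain f g where f: "f \<in> alg (inside \<Gamma>)" "\<not> f constant_on closure (inside \<Gamma>)"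
      and g: "g \<in> alg V" "\<not> g constant_on closure V"
      and eq: "\<And>z. z \<in> \<Gamma> \<Longrightarrow> f z = cnj (g (1 / z))"
      by blast
    define \<psi> where "\<psi> = cnj \<circ> (g \<circ> E) \<circ> cnj"
    have "f \<circ> F \<in> alg (ball 0 1)" "\<not> (f \<circ> F) constant_on cball 0 1"
      using f alg_compose_conformal[OF hF bF F'] by (auto simp: constant_on_comp_image imF)
    moreover have "\<psi> \<in> alg (ball 0 1)" "\<not> \<psi> constant_on cball 0 1"
      using g alg_cnj_reflect[OF alg_compose_conformal[OF E(1,2) E']]
      unfolding \<psi>_def constant_on_cnj_reflect by (auto simp: constant_on_comp_image imE)
    moreover have "\<forall>z\<in>sphere 0 1. (f \<circ> F) z = \<psi> (h z)"
      using weld eq circle by (auto simp: \<psi>_def)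
    ultimately show ?R by blast
  next
    assume ?R
    then obtain \<phi> \<psi> where \<phi>: "\<phi> \<in> alg (ball 0 1)" "\<not> \<phi> constant_on cball 0 1"
      and \<psi>: "\<psi> \<in> alg (ball 0 1)" "\<not> \<psi> constant_on cball 0 1"
      and eq: "\<And>z. z \<in> sphere 0 1 \<Longrightarrow> \<phi> z = \<psi> (h z)"
      by blast
    \<comment> \<open>Obtained by solving the forward formula
      \<open>\<psi> = cnj \<circ> (g \<circ> E) \<circ> cnj\<close> for \<open>g\<close>, with
      \<open>E'\<close> inverting \<open>E\<close> on the closed disk.\<close>
    define g where "g = (cnj \<circ> \<psi> \<circ> cnj) \<circ> E'"
    have "\<phi> \<circ> F' \<in> alg (inside \<Gamma>)" "\<not> (\<phi> \<circ> F') constant_on closure (inside \<Gamma>)"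
      using \<phi> alg_compose_conformal_inverse[OF hF bF F'] by (auto simp: constant_on_comp_image imF')
    moreover have "g \<in> alg V"
      unfolding g_def by (intro alg_compose_conformal_inverse[OF E(1,2) E'] alg_cnj_reflect \<psi>) simp
    moreover have "\<not> g constant_on closure V"
      unfolding g_def constant_on_comp_image[of _ E'] imE' constant_on_cnj_reflect by (rule \<psi>)
    moreover have "\<forall>z\<in>\<Gamma>. (\<phi> \<circ> F') z = cnj (g (1 / z))"
    proof
      fix z assume "z \<in> \<Gamma>"
      then obtain w where w: "w \<in> sphere 0 1" "z = F w" using circle by blast
      have "F' (F w) = w" using F' w by (simp add: homeomorphism_def)
      \<comment> \<open>By \<open>weld\<close>, \<open>1 / z\<close> equals
        \<open>E (cnj (h w))\<close>. Since \<open>cnj (h w)\<close> lies in the closed disk,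
        \<open>E'\<close> recovers it, and the conjugations in \<open>g\<close> cancel to leave
        \<open>\<psi> (h w)\<close>.\<close>
      moreover have "cnj (h w) \<in> cball 0 1" using weld[OF w(1)] by simp
      then have "E' (E (cnj (h w))) = cnj (h w)"
        using E' by (metis closure_ball homeomorphism_apply1 zero_less_one)
      ultimately show "(\<phi> \<circ> F') z = cnj (g (1 / z))"
        using weld[OF w(1)] eq[OF w(1)] w(2) by (simp add: g_def)
    qed
    ultimately show "\<exists>f\<in>alg (inside \<Gamma>). \<exists>g\<in>alg V. \<not> f constant_on closure (inside \<Gamma>) \<and>
      \<not> g constant_on closure V \<and> (\<forall>z\<in>\<Gamma>. f z = cnj (g (1 / z)))"
      by blast
  qed
  finally show ?thesis .
qed

end
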